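(* Let $\Theta\subseteq\mathbb{R}$ be a nondegenerate open interval, and let $(X,\mathcal{X})$ be a measurable space, with $X$ nonempty, such that there is a countable subset of $\mathcal{X}$ which separates the points of $X$ (equivalently, $(X,\mathcal{X})$ has a measurable diagonal). Let $\psi\in\Psi[Z](X,\Theta)$ be such that, for all $r\in\Theta$, the function $X\ni y\mapsto\psi(y,r)$ takes both positive and negative values. Suppose that, for each $n\in\mathbb{N}$, the map $\vartheta_{n,\psi}:X^n\to\Theta$ is measurable with respect to the $n$-fold product sigma-algebra $\mathcal{X}^n$ and the Borel sigma-algebra on $\Theta$. Then $\psi$ is measurable in its first variable, i.e., for all $t\in\Theta$, the map $X\ni x\mapsto\psi(x,t)$ is measurable with respect to $\mathcal{X}$ and the Borel sigma-algebra on $\mathbb{R}$.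
   Context: $\mathbb{N}$ is the set of positive integers. An interval is nondegenerate if it contains at least two distinct points. A family $\mathcal{E}$ of subsets of $X$ separates the points of $X$ if for any two distinct points $x,y\in X$ there exists $E\in\mathcal{E}$ such that either $x\in E$ and $y\notin E$, or $y\in E$ and $x\notin E$. "Countable" means at most countable. $(X,\mathcal{X})$ has a measurable diagonal if $\{(x,x):x\in X\}\in\mathcal{X}\otimes\mathcal{X}$; it is a known theorem (Bogachev, Measure Theory, Theorem 6.5.7) that this is equivalent to the existence of a countable subset of $\mathcal{X}$ separating the points of $X$. $\Psi(X,\Theta)$ denotes the class of functions $\psi:X\times\Theta\to\mathbb{R}$ such that, for all $x\in X$, there exist $t_+,t_-\in\Theta$ with $t_+<t_-$ and $\psi(x,t_+)>0>\psi(x,t_-)$. $\Psi[Z](X,\Theta)$ denotes the class of those $\psi\in\Psi(X,\Theta)$ such that, for every $n\in\mathbb{N}$, there exists a (necessarily unique) map $\vartheta_{n,\psi}:X^n\to\Theta$ such that, for all $(x_1,\dots,x_n)\in X^n$ and $t\in\Theta$: $\sum_{i=1}^n\psi(x_i,t)>0$ if $t<\vartheta_{n,\psi}(x_1,\dots,x_n)$, $\sum_{i=1}^n\psi(x_i,t)<0$ if $t>\vartheta_{n,\psi}(x_1,\dots,x_n)$, and $\sum_{i=1}^n\psi(x_i,\vartheta_{n,\psi}(x_1,\dots,x_n))=0$. *)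

theory Defs
  imports "HOL-Analysis.Analysis"
begin

definition nondegenerate_open_interval :: "real set \<Rightarrow> bool" where
  "nondegenerate_open_interval \<Theta> \<longleftrightarrow>
     open \<Theta> \<and> is_interval \<Theta> \<and> (\<exists>a\<in>\<Theta>. \<exists>b\<in>\<Theta>. a \<noteq> b)"

definition separates_points :: "'a set set \<Rightarrow> 'a set \<Rightarrow> bool" where
  "separates_points \<E> X \<longleftrightarrow>
     (\<forall>x\<in>X. \<forall>y\<in>X. x \<noteq> y \<longrightarrow> (\<exists>E\<in>\<E>. (x \<in> E \<and> y \<notin> E) \<or> (y \<in> E \<and> x \<notin> E)))"

text \<open>A function on \<open>X \<times> \<Theta>\<close> is represented by a curried total function; every condition below
  refers only to its values on \<open>X \<times> \<Theta>\<close>.\<close>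

definition Psi :: "'a set \<Rightarrow> real set \<Rightarrow> ('a \<Rightarrow> real \<Rightarrow> real) set" where
  "Psi X \<Theta> = {\<psi>. \<forall>x\<in>X. \<exists>tp\<in>\<Theta>. \<exists>tm\<in>\<Theta>. tp < tm \<and> \<psi> x tp > 0 \<and> 0 > \<psi> x tm}"

abbreviation tuples :: "'a set \<Rightarrow> nat \<Rightarrow> (nat \<Rightarrow> 'a) set" where
  "tuples X n \<equiv> {1..n} \<rightarrow>\<^sub>E X"

text \<open>Maps \<open>X\<^sup>n \<rightarrow> \<Theta>\<close> are taken extensional (with value \<open>undefined\<close> off \<open>X\<^sup>n\<close>), so that the
  map below is unique as a HOL function whenever it exists.\<close>

definition is_zero_map ::
  "'a set \<Rightarrow> real set \<Rightarrow> ('a \<Rightarrow> real \<Rightarrow> real) \<Rightarrow> nat \<Rightarrow> ((nat \<Rightarrow> 'a) \<Rightarrow> real) \<Rightarrow> bool" where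
  "is_zero_map X \<Theta> \<psi> n \<theta> \<longleftrightarrow>
     \<theta> \<in> tuples X n \<rightarrow>\<^sub>E \<Theta> \<and>
     (\<forall>x\<in>tuples X n. \<forall>t\<in>\<Theta>.
        (t < \<theta> x \<longrightarrow> (\<Sum>i=1..n. \<psi> (x i) t) > 0) \<and>
        (t > \<theta> x \<longrightarrow> (\<Sum>i=1..n. \<psi> (x i) t) < 0) \<and>
        (\<Sum>i=1..n. \<psi> (x i) (\<theta> x)) = 0)"

definition Psi_Z :: "'a set \<Rightarrow> real set \<Rightarrow> ('a \<Rightarrow> real \<Rightarrow> real) set" where
  "Psi_Z X \<Theta> = {\<psi> \<in> Psi X \<Theta>. \<forall>n\<ge>1. \<exists>\<theta>. is_zero_map X \<Theta> \<psi> n \<theta>}"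

definition vartheta ::
  "'a set \<Rightarrow> real set \<Rightarrow> ('a \<Rightarrow> real \<Rightarrow> real) \<Rightarrow> nat \<Rightarrow> (nat \<Rightarrow> 'a) \<Rightarrow> real" where
  "vartheta X \<Theta> \<psi> n = (THE \<theta>. is_zero_map X \<Theta> \<psi> n \<theta>)"

lemma is_zero_map_unique:
  assumes "is_zero_map X \<Theta> \<psi> n \<theta>" and "is_zero_map X \<Theta> \<psi> n \<theta>'"
  shows "\<theta> = \<theta>'"
proof (rule PiE_ext)
  show "\<theta> \<in> tuples X n \<rightarrow>\<^sub>E \<Theta>" "\<theta>' \<in> tuples X n \<rightarrow>\<^sub>E \<Theta>"
    using assms by (simp_all add: is_zero_map_def)
next
  fix x assume x: "x \<in> tuples X n"
  have "\<theta> x \<in> \<Theta>" "\<theta>' x \<in> \<Theta>"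
    using assms x unfolding is_zero_map_def by (blast dest: PiE_mem)+
  then show "\<theta> x = \<theta>' x"
    using assms x unfolding is_zero_map_def by (metis less_irrefl linorder_neqE)
qed

lemma is_zero_map_vartheta:
  assumes "\<psi> \<in> Psi_Z X \<Theta>" and "n \<ge> 1"
  shows "is_zero_map X \<Theta> \<psi> n (vartheta X \<Theta> \<psi> n)"
proof -
  obtain \<theta> where "is_zero_map X \<Theta> \<psi> n \<theta>"
    using assms by (auto simp: Psi_Z_def)
  then show ?thesis
    unfolding vartheta_def using is_zero_map_unique by (metis (mono_tags) theI)
qed

end

theory Submission
  imports Defs
begin

text \<open>Fix \<open>t \<in> \<Theta>\<close> and write \<open>f = \<psi>(\<cdot>, t)\<close>. The zero \<open>\<vartheta>\<^sub>n(x)\<close> lies to the right of \<open>t\<close> exactly when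
  \<open>f(x\<^sub>1) + \<dots> + f(x\<^sub>n) > 0\<close>, so measurability of \<open>\<vartheta>\<^sub>n\<close> makes this set of \<open>n\<close>-tuples measurable.
  Pulling it back along the map that sends \<open>x\<close> to the tuple of \<open>k\<close> copies of \<open>x\<close> followed by \<open>m\<close>
  copies of a fixed point \<open>y\<close>, which is measurable because each of its components is, shows that
  \<open>{x. k f(x) + m f(y) > 0}\<close> is measurable (\<open>measurable_weighted_sum_pos\<close>). Hence
  \<open>{x. f(x) > s}\<close> is measurable for every threshold \<open>s = - m f(y) / k\<close>.

  A value \<open>p > 0\<close> of \<open>f\<close> yields all nonpositive rational multiples of \<open>p\<close> as thresholds, a value
  \<open>q < 0\<close> all nonnegative rational multiples of \<open>- q\<close>; together they are dense in the
  real line (\<open>ex_scaled_threshold\<close>). Every set \<open>{x. f(x) > c}\<close> is therefore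
  a countable union of sets already known to be measurable.\<close>

lemma is_zero_map_less_iff:
  assumes "is_zero_map X \<Theta> \<psi> n \<theta>" and "x \<in> tuples X n" and "t \<in> \<Theta>"
  shows "t < \<theta> x \<longleftrightarrow> 0 < (\<Sum>i=1..n. \<psi> (x i) t)"
  using assms unfolding is_zero_map_def
  by (metis less_irrefl less_asym linorder_neqE)

lemma measurable_weighted_sum_pos:
  fixes M :: "'a measure" and \<psi> :: "'a \<Rightarrow> real \<Rightarrow> real" and k m :: nat
  assumes zero: "is_zero_map (space M) \<Theta> \<psi> (k + m) \<theta>"
    and meas: "\<theta> \<in> measurable (PiM {1..k + m} (\<lambda>_. M)) (restrict_space borel \<Theta>)"
    and t: "t \<in> \<Theta>" and y: "y \<in> space M"
  shows "{x \<in> space M. 0 < real k * \<psi> x t + real m * \<psi> y t} \<in> sets M"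
proof -
  define dup where "dup x = (\<lambda>i\<in>{1..k + m}. if i \<le> k then x else y)" for x
  have dup: "dup \<in> measurable M (PiM {1..k + m} (\<lambda>_. M))"
    unfolding dup_def using y by (intro measurable_restrict) simp
  have "\<theta> \<in> borel_measurable (PiM {1..k + m} (\<lambda>_. M))"
    using meas by (simp add: measurable_restrict_space2_iff)
  then have "(\<lambda>x. \<theta> (dup x)) \<in> borel_measurable M"
    by (rule measurable_compose[OF dup])
  then have "{x \<in> space M. t < \<theta> (dup x)} \<in> sets M"
    by measurable
  also have "{x \<in> space M. t < \<theta> (dup x)}
      = {x \<in> space M. 0 < real k * \<psi> x t + real m * \<psi> y t}"
  proof (intro Collect_cong conj_cong refl)
    fix x assume "x \<in> space M"
    then have "dup x \<in> tuples (space M) (k + m)"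
      using y by (auto simp: dup_def)
    then have "t < \<theta> (dup x) \<longleftrightarrow> 0 < (\<Sum>i=1..k + m. \<psi> (dup x i) t)"
      using is_zero_map_less_iff[OF zero _ t] by blast
    also have "(\<Sum>i=1..k + m. \<psi> (dup x i) t)
        = (\<Sum>i=1..k. \<psi> (dup x i) t) + (\<Sum>i=k + 1..k + m. \<psi> (dup x i) t)"
      by (rule sum.ub_add_nat) simp
    also have "\<dots> = real k * \<psi> x t + real m * \<psi> y t"
      by (simp add: dup_def)
    finally show "t < \<theta> (dup x) \<longleftrightarrow> 0 < real k * \<psi> x t + real m * \<psi> y t" .
  qed
  finally show ?thesis .
qed

lemma ex_nat_fraction_between:
  fixes a b :: real
  assumes "0 \<le> a" and "a < b"
  obtains k m :: nat where "1 \<le> k" "real k * a < real m" "real m < real k * b"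
proof -
  obtain r where r: "r \<in> \<rat>" "a < r" "r < b"
    using Rats_dense_in_real[OF assms(2)] by blast
  obtain m k :: nat where "k \<noteq> 0" "\<bar>r\<bar> = real m / real k"
    using Rats_abs_nat_div_natE[OF r(1)] by blast
  with r assms(1) have "real m = real k * r"
    by (simp add: field_simps)
  with r \<open>k \<noteq> 0\<close> show thesis
    by (intro that[of k m]) simp_all
qed

text \<open>The thresholds \<open>- m v / k\<close> with \<open>v \<in> {p, q}\<close> are dense, stated with denominators cleared.
  The sign of \<open>v\<close> must be opposite to that of the threshold sought, which is why values
  of both signs are required.\<close>

lemma ex_scaled_threshold:
  fixes c d p q :: real
  assumes "c < d" and "q < 0" and "0 < p"
  shows "\<exists>k m :: nat. \<exists>v\<in>{p, q}. 1 \<le> k \<and> real k * c + real m * v \<le> 0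
           \<and> 0 < real k * d + real m * v"
proof (cases "0 \<le> c")
  case True
  \<comment> \<open>Divided by \<open>- q\<close>, the numbers \<open>c\<close> and \<open>d\<close> bound a nonnegative interval.\<close>
  then have "0 \<le> c / (- q)" "c / (- q) < d / (- q)"
    using assms by (simp_all add: field_simps)
  then obtain k m :: nat where "1 \<le> k" "real k * (c / (- q)) < real m" "real m < real k * (d / (- q))"
    by (rule ex_nat_fraction_between)
  then have "1 \<le> k \<and> real k * c + real m * q \<le> 0 \<and> 0 < real k * d + real m * q"
    using assms by (simp add: field_simps)
  then show ?thesis
    by blast
next
  case False
  \<comment> \<open>A negative threshold between \<open>c\<close> and \<open>min d 0\<close> is sought; its negative lies between
    \<open>max (- d) 0\<close> and \<open>- c\<close>.\<close>
  then have "max (- d) 0 < - c"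
    using assms(1) by simp
  then have "max (- d) 0 / p < - c / p"
    using assms(3) by (rule divide_strict_right_mono)
  moreover have "0 \<le> max (- d) 0 / p"
    using assms(3) by simp
  ultimately obtain k m :: nat where km: "1 \<le> k" "real k * (max (- d) 0 / p) < real m"
      "real m < real k * (- c / p)"
    using ex_nat_fraction_between by blast
  have "real k * (- d) \<le> real k * max (- d) 0"
    by (intro mult_left_mono) auto
  also have "\<dots> < real m * p"
    using km(2) assms by (simp add: field_simps)
  finally have "1 \<le> k \<and> real k * c + real m * p \<le> 0 \<and> 0 < real k * d + real m * p"
    using km assms by (simp add: field_simps)
  then show ?thesis
    by blast
qed

theorem theorem3p3:
  fixes M :: "'a measure" and \<Theta> :: "real set" and \<psi> :: "'a \<Rightarrow> real \<Rightarrow> real"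
  assumes "nondegenerate_open_interval \<Theta>"
    and "space M \<noteq> {}"
    and "\<exists>\<E>. countable \<E> \<and> \<E> \<subseteq> sets M \<and> separates_points \<E> (space M)"
    and "\<psi> \<in> Psi_Z (space M) \<Theta>"
    and "\<forall>r\<in>\<Theta>. (\<exists>y\<in>space M. \<psi> y r > 0) \<and> (\<exists>y\<in>space M. \<psi> y r < 0)"
    and "\<forall>n\<ge>1. vartheta (space M) \<Theta> \<psi> n
           \<in> measurable (PiM {1..n} (\<lambda>_. M)) (restrict_space borel \<Theta>)"
  shows "\<forall>t\<in>\<Theta>. (\<lambda>x. \<psi> x t) \<in> measurable M borel"
proof
  fix t assume t: "t \<in> \<Theta>"
  obtain y z where y: "y \<in> space M" "0 < \<psi> y t" and z: "z \<in> space M" "\<psi> z t < 0"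
    using assms(5) t by blast
  have pos: "{x \<in> space M. 0 < real k * \<psi> x t + real m * v} \<in> sets M"
    if "1 \<le> k" "v \<in> {\<psi> y t, \<psi> z t}" for k m :: nat and v
  proof -
    have "1 \<le> k + m"
      using that(1) by simp
    note zero = is_zero_map_vartheta[OF assms(4) this] assms(6)[rule_format, OF this]
    show ?thesis
      using that(2) measurable_weighted_sum_pos[OF zero t y(1)]
        measurable_weighted_sum_pos[OF zero t z(1)]
      by auto
  qed
  show "(\<lambda>x. \<psi> x t) \<in> borel_measurable M"
  proof (rule borel_measurableI_greater)
    fix c
    define T where "T = {(k, m, v). 1 \<le> k \<and> v \<in> {\<psi> y t, \<psi> z t}
      \<and> real k * c + real m * v \<le> 0}"
    have "T \<subseteq> (UNIV :: nat set) \<times> (UNIV :: nat set) \<times> {\<psi> y t, \<psi> z t}"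
      by (auto simp: T_def)
    then have "countable T"
      by (rule countable_subset) (intro countable_SIGMA countableI_type countable_finite; simp)
    then have "(\<Union>(k, m, v)\<in>T. {x \<in> space M. 0 < real k * \<psi> x t + real m * v}) \<in> sets M"
      by (rule sets.countable_UN') (use pos in \<open>auto simp: T_def\<close>)
    also have "(\<Union>(k, m, v)\<in>T. {x \<in> space M. 0 < real k * \<psi> x t + real m * v})
        = {x \<in> space M. c < \<psi> x t}"
    proof (intro equalityI subsetI)
      fix x assume "x \<in> (\<Union>(k, m, v)\<in>T. {x \<in> space M. 0 < real k * \<psi> x t + real m * v})"
      then obtain k m v where "(k, m, v) \<in> T" "x \<in> space M" "0 < real k * \<psi> x t + real m * v"
        by auto
      then have "real k * c + real m * v \<le> 0" "0 < real k * \<psi> x t + real m * v"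
        unfolding T_def by simp_all
      then have "real k * c < real k * \<psi> x t"
        by linarith
      then show "x \<in> {x \<in> space M. c < \<psi> x t}"
        using \<open>x \<in> space M\<close> by (simp add: mult_less_cancel_left)
    next
      fix x assume "x \<in> {x \<in> space M. c < \<psi> x t}"
      then show "x \<in> (\<Union>(k, m, v)\<in>T. {x \<in> space M. 0 < real k * \<psi> x t + real m * v})"
        using ex_scaled_threshold[of c "\<psi> x t" "\<psi> z t" "\<psi> y t"] y(2) z(2)
        unfolding T_def by fastforce
    qed
    finally show "{x \<in> space M. c < \<psi> x t} \<in> sets M" .
  qed
qed

end
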